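(* Consider the game, the mixing matrix $W$ and Algorithm 1 described in the context, and suppose that: (1) for every $i\in[n]$, $\Omega_i\subseteq\mathbb{R}$ is convex and closed, and $J_i(x_i,x_{-i})$ is convex and continuously differentiable in $x_i$ for each fixed $x_{-i}$; (2) for every $i\in[n]$ there are constants $L_i,L_{-i}\ge 0$ such that $|\nabla_iJ_i(x_i,x_{-i})-\nabla_iJ_i(y_i,x_{-i})|\le L_i|x_i-y_i|$ for all $x_i,y_i\in\Omega_i$ and $x_{-i}\in\mathbb{R}^{n-1}$, and $|\nabla_iJ_i(x_i,x_{-i})-\nabla_iJ_i(x_i,y_{-i})|\le L_{-i}\|x_{-i}-y_{-i}\|$ for all $x_i\in\Omega_i$ and $x_{-i},y_{-i}\in\mathbb{R}^{n-1}$; put $L=\max_{i\in[n]}\sqrt{L_i^2+L_{-i}^2}$; (3) the communication graph is connected, and $W=[w_{ij}]\in\mathbb{R}^{n\times n}$ is a non-negative symmetric matrix with $w_{ij}>0$ if and only if $\{i,j\}\in\mathcal{A}$ and $\sum_{j=1}^n w_{ij}=1$ for all $i\in[n]$. Let $\alpha_t,\lambda_t>0$ be the parameters of Algorithm 1, and let $\{\eta_t\}_{t\ge0}\subset(0,1)$ and $\{\theta_t\}_{t\ge0}\subset(0,\infty)$ be sequences such that $$\theta_{t-1}\eta_t(1-\eta_{t-1})\ge\theta_tL^2\alpha_t^2\lambda_t^2\ \text{ for all }t\ge1,\qquad \theta_{t+1}\alpha_{t+1}\lambda_{t+1}=\theta_t\alpha_t\ \text{ for all }t\ge0.$$ Then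 for any consensus matrix $\mathbf{x}=\mathbf{x}_{||}\in\Omega_a$ (all of whose rows equal some joint action $x\in\Omega$) and for all $k\ge1$, $$\sum_{t=1}^{k}\left[\theta_t\alpha_t\langle\mathbf{F}(\mathbf{x}^{t+1}),\mathbf{x}^{t+1}-\mathbf{x}\rangle+\frac{\theta_t(1-\eta_t)}{2}\|\mathbf{x}^{t+1}-\mathbf{x}\|^2\right]-\frac{L^2\theta_k\alpha_k^2}{2(1-\eta_k)}\|\mathbf{x}^{k+1}-\mathbf{x}\|^2\le\sum_{t=1}^k\left[\theta_tb_{1,t}\|\mathbf{x}^t_{||}-\mathbf{x}\|^2+\theta_tb_{2,t}\|\mathbf{x}^t_{\bot}\|^2\right],$$ with $b_{1,t}=\frac{1+\eta_t\|W-I\|^2}{2}$ and $b_{2,t}=\frac{(1-\eta_t)\sigma^2+\eta_t(1+\|W-I\|^2)}{2}$.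
   Context: Game. There are $n$ players, $[n]=\{1,\dots,n\}$. Player $i$ has action set $\Omega_i\subseteq\mathbb{R}$ and cost function $J_i(x_i,x_{-i})$ defined on $\mathbb{R}^n$, with $x_i$ the player's own action and $x_{-i}$ the vector of the other players' actions. $\Omega=\Omega_1\times\cdots\times\Omega_n$. $\nabla_i$ denotes the partial derivative with respect to $x_i$. Players communicate over an undirected graph with node set $[n]$ and arc set $\mathcal{A}$, with an associated mixing matrix $W$. $\sigma$ denotes the second largest singular value of $W$, and $\sigma\in(0,1)$. $I$ is the $n\times n$ identity matrix. Norms. On $\mathbb{R}^n$: Euclidean inner product and norm. On $\mathbb{R}^{n\times n}$: Frobenius inner product $\langle u,v\rangle=\mathrm{trace}(u^Tv)$ and Frobenius norm $\|\cdot\|$. Estimation matrices. Each player $i$ holds a vector $x_{(i)}\in\mathbb{R}^n$ whose $i$-th entry is its own action $x_i$ and whose other entries are estimates of the other players' actions. $\mathbf{x}\in\mathbb{R}^{n\times n}$ is the matrix whose $i$-th row is $x_{(i)}^T$. $\mathrm{diag}(\mathbf{x})\in\mathbb{R}^n$ is the vector of diagonal entries. $\Omega_a=\{\mathbf{x}\in\mathbb{R}^{n\times n}:\mathrm{diag}(\mathbf{x})\in\Omega\}$. $\mathbf{F}(\mathbf{x})$ is the diagonal $n\times n$ matrix with diagonal entries $\nabla_iJ_i(x_{(i)})$, $i=1,\dots,n$. For a matrix $\mathbf{x}$, $\mathbf{x}_{||}=\frac1n\mathbf{1}\mathbf{1}^T\mathbf{x}$ and $\mathbf{x}_{\bot}=\mathbf{x}-\mathbf{x}_{||}$,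 where $\mathbf{1}$ is the all-ones vector. A consensus matrix is a matrix with all rows equal, i.e. $\mathbf{x}=\mathbf{x}_{||}$. Algorithm 1 (with step sizes $\alpha_k>0$ and parameters $\lambda_k>0$). Pick an arbitrary $\mathbf{x}^0\in\Omega_a$, set $\hat{\mathbf{x}}^0=W\mathbf{x}^0$ and $\mathbf{x}^1=\hat{\mathbf{x}}^0$. For $k=1,2,\dots$: $\hat{\mathbf{x}}^k=W\mathbf{x}^k$ and $$\mathbf{x}^{k+1}=\mathcal{P}_{\Omega_a}\left\{\hat{\mathbf{x}}^k-\alpha_k\left(\mathbf{F}(\hat{\mathbf{x}}^k)+\lambda_k(\mathbf{F}(\mathbf{x}^k)-\mathbf{F}(\hat{\mathbf{x}}^{k-1}))\right)\right\},$$ where $\mathcal{P}_{\Omega_a}$ is the (Frobenius-norm) projection onto $\Omega_a$. (The value $\alpha_0>0$ enters only through the conditions on the sequences.)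
   Formalization: Added hypothesis: the own-action Lipschitz bound of (2) with constant L_i also holds between points of Ω_i and the own actions (diagonal entries) of the mixed iterates x̂^k, k≥1, which may leave Ω_i; without it the claim fails. It is automatic if Ω_i=ℝ or all rows of x^0 lie in Ω. *)

theory Defs
  imports "HOL-Analysis.Analysis"
begin

text \<open>Costs are functions of the full action vector in \<open>real^'n\<close>. A pair of an own action \<open>a\<close> of
  player \<open>i\<close> and a vector of opponents' actions is encoded as \<open>set_action i a z\<close>, where the
  \<open>i\<close>-th entry of \<open>z\<close> is irrelevant.\<close>

definition set_action :: "'n \<Rightarrow> real \<Rightarrow> real^'n \<Rightarrow> real^'n" where
  "set_action i a z = (\<chi> j. if j = i then a else z $ j)"

definition own_grad :: "('n \<Rightarrow> real^'n \<Rightarrow> real) \<Rightarrow> 'n \<Rightarrow> real^'n \<Rightarrow> real" where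
  "own_grad J i x = deriv (\<lambda>a. J i (set_action i a x)) (x $ i)"

definition own_lipschitz ::
  "('n \<Rightarrow> real^'n \<Rightarrow> real) \<Rightarrow> 'n \<Rightarrow> real set \<Rightarrow> real set \<Rightarrow> real \<Rightarrow> bool" where
  "own_lipschitz J i A B c \<longleftrightarrow>
     (\<forall>a\<in>A. \<forall>b\<in>B. \<forall>z. \<bar>own_grad J i (set_action i a z) - own_grad J i (set_action i b z)\<bar>
        \<le> c * \<bar>a - b\<bar>)"

text \<open>The \<open>L2_set\<close> below is the Euclidean norm of the difference of the opponents' actions.\<close>

definition others_lipschitz ::
  "('n::finite \<Rightarrow> real^'n \<Rightarrow> real) \<Rightarrow> 'n \<Rightarrow> real set \<Rightarrow> real \<Rightarrow> bool" where
  "others_lipschitz J i A c \<longleftrightarrow>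
     (\<forall>a\<in>A. \<forall>y z. \<bar>own_grad J i (set_action i a y) - own_grad J i (set_action i a z)\<bar>
        \<le> c * L2_set (\<lambda>j. y $ j - z $ j) (- {i}))"

text \<open>Matrices are \<open>real^'n^'n\<close>: \<open>x $ i\<close> is the \<open>i\<close>-th row, and the library's \<open>inner\<close> and \<open>norm\<close>
  on this type are the Frobenius ones.\<close>

definition diag :: "real^'n^'n \<Rightarrow> real^'n" where
  "diag x = (\<chi> i. x $ i $ i)"

definition action_profiles :: "('n \<Rightarrow> real set) \<Rightarrow> (real^'n) set" where
  "action_profiles \<Omega> = {v. \<forall>i. v $ i \<in> \<Omega> i}"

definition Omega_a :: "('n \<Rightarrow> real set) \<Rightarrow> (real^'n^'n) set" where
  "Omega_a \<Omega> = {x. diag x \<in> action_profiles \<Omega>}"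

definition grad_matrix :: "('n \<Rightarrow> real^'n \<Rightarrow> real) \<Rightarrow> real^'n^'n \<Rightarrow> real^'n^'n" where
  "grad_matrix J x = (\<chi> i j. if i = j then own_grad J i (row i x) else 0)"

definition par_part :: "real^'n^'n \<Rightarrow> real^'n^'n" where
  "par_part x = (1 / real CARD('n)) *\<^sub>R ((\<chi> i j. 1) ** x)"

definition perp_part :: "real^'n^'n \<Rightarrow> real^'n^'n" where
  "perp_part x = x - par_part x"

text \<open>Singular values of \<open>A\<close> are the \<open>s \<ge> 0\<close> with \<open>s\<^sup>2\<close> an eigenvalue of the symmetric matrix
  \<open>A\<^sup>T A\<close>; the multiplicity is the dimension of the eigenspace. The second largest one is taken
  with multiplicity: the largest \<open>s\<close> such that at least two singular values, counted with
  multiplicity, are \<open>\<ge> s\<close>.\<close>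

definition singular_multiplicity :: "real^'n^'n \<Rightarrow> real \<Rightarrow> nat" where
  "singular_multiplicity A s = dim {v. (transpose A ** A) *v v = s\<^sup>2 *\<^sub>R v}"

definition singular_values :: "real^'n^'n \<Rightarrow> real set" where
  "singular_values A = {s. 0 \<le> s \<and> 0 < singular_multiplicity A s}"

definition second_singular_value :: "real^'n^'n \<Rightarrow> real" where
  "second_singular_value A =
     Max {s \<in> singular_values A.
       2 \<le> (\<Sum>r \<in> {r \<in> singular_values A. s \<le> r}. singular_multiplicity A r)}"

text \<open>Arcs are unordered pairs; \<open>{i, i} = {i}\<close> is a self-loop, so that the diagonal of a
  mixing matrix may be positive.\<close>

definition undirected_arcs :: "'n set set \<Rightarrow> bool" where
  "undirected_arcs \<A> \<longleftrightarrow> (\<forall>e\<in>\<A>. \<exists>i j. e = {i, j})"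

definition graph_connected :: "'n set set \<Rightarrow> bool" where
  "graph_connected \<A> \<longleftrightarrow> (\<forall>i j. (i, j) \<in> {(u, v). {u, v} \<in> \<A>}\<^sup>*)"

definition mixing_matrix :: "'n::finite set set \<Rightarrow> real^'n^'n \<Rightarrow> bool" where
  "mixing_matrix \<A> W \<longleftrightarrow>
     (\<forall>i j. 0 \<le> W $ i $ j) \<and> transpose W = W \<and>
     (\<forall>i j. 0 < W $ i $ j \<longleftrightarrow> {i, j} \<in> \<A>) \<and> (\<forall>i. (\<Sum>j\<in>UNIV. W $ i $ j) = 1)"

text \<open>\<open>X\<close> and \<open>X'\<close> are the sequences of iterates and of mixed iterates.\<close>

definition algorithm_run ::
  "('n::finite \<Rightarrow> real^'n \<Rightarrow> real) \<Rightarrow> ('n \<Rightarrow> real set) \<Rightarrow> real^'n^'n \<Rightarrow> (nat \<Rightarrow> real) \<Rightarrow> (nat \<Rightarrow> real)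
     \<Rightarrow> (nat \<Rightarrow> real^'n^'n) \<Rightarrow> (nat \<Rightarrow> real^'n^'n) \<Rightarrow> bool" where
  "algorithm_run J \<Omega> W \<alpha> lam X X' \<longleftrightarrow>
     X 0 \<in> Omega_a \<Omega> \<and> (\<forall>k. X' k = W ** X k) \<and> X 1 = X' 0 \<and>
     (\<forall>k\<ge>1. X (k + 1) = closest_point (Omega_a \<Omega>)
        (X' k - \<alpha> k *\<^sub>R (grad_matrix J (X' k)
                 + lam k *\<^sub>R (grad_matrix J (X k) - grad_matrix J (X' (k - 1))))))"

text \<open>Only the diagonal of an iterate is constrained, so the own action \<open>X' k $ i $ i\<close> at which the
  run evaluates the gradient of player \<open>i\<close> can leave \<open>\<Omega> i\<close>, where a Lipschitz condition on
  \<open>\<Omega> i\<close> says nothing. The next condition extends the bound to these own actions. It follows from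
  \<open>own_lipschitz J i (\<Omega> i) (\<Omega> i) (L i)\<close> when every \<open>X' k\<close> lies in \<open>Omega_a \<Omega>\<close>, in
  particular when all rows of \<open>X 0\<close> are in \<open>action_profiles \<Omega>\<close> and the \<open>\<Omega> i\<close> are convex, and
  from a Lipschitz bound on the whole line.\<close>

definition own_lipschitz_at_mixed ::
  "('n \<Rightarrow> real^'n \<Rightarrow> real) \<Rightarrow> ('n \<Rightarrow> real set) \<Rightarrow> (nat \<Rightarrow> real^'n^'n) \<Rightarrow> ('n \<Rightarrow> real) \<Rightarrow> bool" where
  "own_lipschitz_at_mixed J \<Omega> X' L \<longleftrightarrow>
     (\<forall>i. own_lipschitz J i (\<Omega> i) {X' k $ i $ i | k. 1 \<le> k} (L i))"

end

theory Submission
  imports Defs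
begin

text \<open>With \<open>\<Delta>\<^sub>t = F(x\<^sup>t\<^sup>+\<^sup>1) - F(X'\<^sup>t)\<close>, the variational inequality of the projection bounds
  \<open>\<theta>\<^sub>t \<alpha>\<^sub>t \<langle>F(x\<^sup>t\<^sup>+\<^sup>1), x\<^sup>t\<^sup>+\<^sup>1 - x\<rangle>\<close> by squared distances plus the terms
  \<open>\<theta>\<^sub>t \<alpha>\<^sub>t \<langle>\<Delta>\<^sub>t, x\<^sup>t\<^sup>+\<^sup>1 - x\<rangle>\<close>, which telescope because \<open>\<theta>\<^sub>t \<alpha>\<^sub>t \<lambda>\<^sub>t\<close> is the previous
  \<open>\<theta> \<alpha>\<close>, and a remainder \<open>\<langle>\<Delta>\<^sub>t\<^sub>-\<^sub>1, x\<^sup>t\<^sup>+\<^sup>1 - x\<^sup>t\<rangle>\<close>. Young's inequality splits the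
  remainder into \<open>\<eta>\<^sub>t |x\<^sup>t\<^sup>+\<^sup>1 - x\<^sup>t|\<^sup>2\<close> and a share \<open>1 - \<eta>\<close> of \<open>|x\<^sup>t - X'\<^sup>t\<^sup>-\<^sup>1|\<^sup>2\<close>, which the
  previous step pays for. There is no initial term, since \<open>x\<^sup>1 = X'\<^sup>0\<close>. What is left
  depends on \<open>x\<^sup>t\<close> alone, through the contraction of \<open>W\<close> by \<open>\<sigma>\<close> on \<open>1\<^sup>\<bottom>\<close>.\<close>

section \<open>Frobenius norms by rows and columns\<close>

lemma norm_matrix_power2:
  fixes M :: "real^'m::finite^'n::finite"
  shows "(norm M)\<^sup>2 = (\<Sum>i\<in>UNIV. (norm (M $ i))\<^sup>2)"
  by (simp add: power2_norm_eq_inner inner_vec_def)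

lemma norm_matrix_power2_columns:
  fixes M :: "real^'m::finite^'n::finite"
  shows "(norm M)\<^sup>2 = (\<Sum>j\<in>UNIV. (norm (column j M))\<^sup>2)"
proof -
  have "(norm M)\<^sup>2 = (\<Sum>i\<in>UNIV. \<Sum>j\<in>UNIV. M $ i $ j * M $ i $ j)"
    by (simp add: power2_norm_eq_inner inner_vec_def)
  also have "\<dots> = (\<Sum>j\<in>UNIV. \<Sum>i\<in>UNIV. M $ i $ j * M $ i $ j)"
    by (rule sum.swap)
  finally show ?thesis
    by (simp add: power2_norm_eq_inner inner_vec_def column_def)
qed

lemma column_matrix_mult: "column j (A ** B) = A *v column j B"
  by (simp add: vec_eq_iff column_def matrix_matrix_mult_def matrix_vector_mult_def)

text \<open>Left multiplication acts on each column separately, so a vector bound for the columns of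
  \<open>B\<close> lifts to the Frobenius norm. It serves both for the crude factor
  \<open>norm A\<close> and for the contraction by the second singular value, which is only
  available on columns orthogonal to \<open>1\<close>.\<close>

lemma norm_matrix_mult_le_columns:
  fixes A :: "real^'m::finite^'n::finite" and B :: "real^'p::finite^'m"
  assumes "\<And>j. norm (A *v column j B) \<le> c * norm (column j B)"
  shows "(norm (A ** B))\<^sup>2 \<le> c\<^sup>2 * (norm B)\<^sup>2"
proof -
  have "(norm (A *v column j B))\<^sup>2 \<le> c\<^sup>2 * (norm (column j B))\<^sup>2" for j
    using power_mono[OF assms[of j] norm_ge_zero, of 2] by (simp add: power_mult_distrib)
  then show ?thesis
    unfolding norm_matrix_power2_columns[of "A ** B"] norm_matrix_power2_columns[of B]
      column_matrix_mult sum_distrib_left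
    by (intro sum_mono)
qed

text \<open>Cauchy-Schwarz in each row: the Frobenius norm dominates the operator norm.\<close>

lemma norm_matrix_vector_mult_le:
  fixes A :: "real^'m::finite^'n::finite"
  shows "norm (A *v v) \<le> norm A * norm v"
proof (rule power2_le_imp_le)
  have "(norm (A *v v))\<^sup>2 = (\<Sum>i\<in>UNIV. (A $ i \<bullet> v)\<^sup>2)"
    unfolding norm_eq_sqrt_inner[of "A *v v"] inner_vec_def[of "A *v v"]
    by (simp add: sum_nonneg matrix_vector_mul_component power2_eq_square)
  also have "\<dots> \<le> (\<Sum>i\<in>UNIV. (norm (A $ i))\<^sup>2 * (norm v)\<^sup>2)"
    using Cauchy_Schwarz_ineq by (intro sum_mono) (simp add: power2_norm_eq_inner)
  also have "\<dots> = (norm A * norm v)\<^sup>2"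
    by (simp add: norm_matrix_power2[of A] power_mult_distrib sum_distrib_right)
  finally show "(norm (A *v v))\<^sup>2 \<le> (norm A * norm v)\<^sup>2" .
qed simp

lemma norm_matrix_mult_le:
  fixes A :: "real^'m::finite^'n::finite" and B :: "real^'p::finite^'m"
  shows "(norm (A ** B))\<^sup>2 \<le> (norm A)\<^sup>2 * (norm B)\<^sup>2"
  by (intro norm_matrix_mult_le_columns norm_matrix_vector_mult_le)

lemma matrix_diff_ldistrib: "A ** (B - C) = A ** B - A ** C" for A :: "'a::ring_1^'m^'n"
  by (simp add: vec_eq_iff matrix_matrix_mult_def sum_subtractf right_diff_distrib)

lemma matrix_diff_rdistrib: "(A - B) ** C = A ** C - B ** C" for A :: "'a::ring_1^'m^'n"
  by (simp add: vec_eq_iff matrix_matrix_mult_def sum_subtractf left_diff_distrib)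

section \<open>Singular values with multiplicity\<close>

lemma inner_gram:
  fixes A :: "real^'n::finite^'n"
  shows "((transpose A ** A) *v u) \<bullet> v = (A *v u) \<bullet> (A *v v)"
  by (metis dot_lmul_matrix matrix_vector_mul_assoc transpose_matrix_vector)

lemma singular_values_iff:
  "s \<in> singular_values A \<longleftrightarrow> 0 \<le> s \<and> (\<exists>v. v \<noteq> 0 \<and> (transpose A ** A) *v v = s\<^sup>2 *\<^sub>R v)"
  unfolding singular_values_def singular_multiplicity_def neq0_conv[symmetric] dim_eq_0
  by blast

text \<open>Eigenvectors of the symmetric matrix \<open>A\<^sup>T A\<close> for distinct eigenvalues are orthogonal, hence
  linearly independent.\<close>

lemma finite_singular_values:
  fixes A :: "real^'n::finite^'n"
  shows "finite (singular_values A)"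
proof -
  define f where
    "f s = (SOME v. v \<noteq> 0 \<and> (transpose A ** A) *v v = s\<^sup>2 *\<^sub>R v)" for s
  have f: "f s \<noteq> 0 \<and> (transpose A ** A) *v f s = s\<^sup>2 *\<^sub>R f s" if "s \<in> singular_values A" for s
    unfolding f_def by (rule someI_ex) (use that singular_values_iff in blast)
  have orth: "f r \<bullet> f s = 0"
    if r: "r \<in> singular_values A" and s: "s \<in> singular_values A" and "r \<noteq> s" for r s
  proof -
    have "r\<^sup>2 * (f r \<bullet> f s) = s\<^sup>2 * (f r \<bullet> f s)"
      using f[OF r] f[OF s] inner_gram[of A "f r" "f s"] inner_gram[of A "f s" "f r"]
      by (simp add: inner_commute)
    moreover have "r\<^sup>2 \<noteq> s\<^sup>2"
      using that by (auto simp: singular_values_def power2_eq_iff_nonneg)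
    ultimately show ?thesis by simp
  qed
  have "inj_on f (singular_values A)"
    by (rule inj_onI) (metis f orth inner_eq_zero_iff)
  moreover have "independent (f ` singular_values A)"
    using f orth by (intro pairwise_orthogonal_independent)
      (auto simp: pairwise_def orthogonal_def)
  ultimately show ?thesis
    using independent_imp_finite finite_imageD by blast
qed

text \<open>Two orthogonal eigenvectors make the count in the definition reach 2: if
  \<open>s = r\<close> they span two dimensions of one eigenspace, otherwise they belong to two
  singular values of multiplicity at least 1 each.\<close>

lemma le_second_singular_value:
  fixes A :: "real^'n::finite^'n"
  assumes "0 \<le> s" "s \<le> r" "v \<noteq> 0" "w \<noteq> 0" "v \<bullet> w = 0"
    and v: "(transpose A ** A) *v v = s\<^sup>2 *\<^sub>R v" and w: "(transpose A ** A) *v w = r\<^sup>2 *\<^sub>R w"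
  shows "s \<le> second_singular_value A"
proof -
  have s: "s \<in> singular_values A" and r: "r \<in> singular_values A"
    using assms unfolding singular_values_iff by auto
  let ?R = "{q \<in> singular_values A. s \<le> q}"
  have fin: "finite ?R" using finite_singular_values[of A] by simp
  have pos: "1 \<le> singular_multiplicity A q" if "q \<in> singular_values A" for q
    using that by (simp add: singular_values_def Suc_le_eq)
  have "2 \<le> (\<Sum>q\<in>?R. singular_multiplicity A q)"
  proof (cases "s = r")
    case True
    have "independent {v, w}"
      using assms by (intro pairwise_orthogonal_independent)
        (auto simp: pairwise_def orthogonal_def inner_commute)
    moreover have "{v, w} \<subseteq> {v. (transpose A ** A) *v v = s\<^sup>2 *\<^sub>R v}"
      using v w True by simp
    ultimately have "card {v, w} \<le> singular_multiplicity A s"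
      unfolding singular_multiplicity_def by (intro independent_card_le_dim)
    moreover have "v \<noteq> w" using assms by auto
    ultimately have "2 \<le> singular_multiplicity A s" by simp
    also have "\<dots> \<le> (\<Sum>q\<in>?R. singular_multiplicity A q)"
      using fin s by (intro member_le_sum) auto
    finally show ?thesis .
  next
    case False
    have "2 \<le> (\<Sum>q\<in>{s, r}. singular_multiplicity A q)"
      using False pos[OF s] pos[OF r] by simp
    also have "\<dots> \<le> (\<Sum>q\<in>?R. singular_multiplicity A q)"
      using fin s r assms by (intro sum_mono2) auto
    finally show ?thesis .
  qed
  then show ?thesis
    unfolding second_singular_value_def using s finite_singular_values[of A]
    by (intro Max_ge) auto
qed

section \<open>Contraction of the mixing matrix\<close>

lemma matrix_vector_mult_ones:
  fixes W :: "real^'n::finite^'n"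
  assumes "\<And>i. (\<Sum>j\<in>UNIV. W $ i $ j) = 1"
  shows "W *v 1 = 1"
  using assms by (simp add: vec_eq_iff matrix_vector_mult_def)

text \<open>Jensen's inequality for the square, with the entries of a row as weights. After the sums
  are swapped, symmetry turns the column sums into row sums, which are 1.\<close>

lemma doubly_stochastic_norm_le:
  fixes W :: "real^'n::finite^'n"
  assumes nonneg: "\<And>i j. 0 \<le> W $ i $ j" and sym: "transpose W = W"
    and rows: "\<And>i. (\<Sum>j\<in>UNIV. W $ i $ j) = 1"
  shows "norm (W *v v) \<le> norm v"
proof (rule power2_le_imp_le)
  have "(\<Sum>j\<in>UNIV. W $ i $ j * v $ j)\<^sup>2 \<le> (\<Sum>j\<in>UNIV. W $ i $ j * (v $ j)\<^sup>2)" for i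
    using convex_on_sum[of UNIV UNIV "\<lambda>x::real. x\<^sup>2" "\<lambda>j. W $ i $ j" "\<lambda>j. v $ j"]
      nonneg rows convex_power2
    by simp
  then have "(\<Sum>i\<in>UNIV. (\<Sum>j\<in>UNIV. W $ i $ j * v $ j)\<^sup>2)
      \<le> (\<Sum>i\<in>UNIV. \<Sum>j\<in>UNIV. W $ i $ j * (v $ j)\<^sup>2)"
    by (intro sum_mono)
  also have "\<dots> = (\<Sum>j\<in>UNIV. (\<Sum>i\<in>UNIV. W $ j $ i) * (v $ j)\<^sup>2)"
  proof -
    have "W $ i $ j = W $ j $ i" for i j
      using sym by (metis transpose_def vec_lambda_beta)
    then show ?thesis
      by (subst sum.swap) (simp add: sum_distrib_right)
  qed
  finally show "(norm (W *v v))\<^sup>2 \<le> (norm v)\<^sup>2"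
    unfolding power2_norm_eq_inner inner_vec_def
    by (simp add: rows matrix_vector_mult_def power2_eq_square)
qed simp

text \<open>The maximum \<open>\<mu>\<close> of \<open>|W v|\<^sup>2\<close> over the unit sphere of \<open>1\<^sup>\<bottom>\<close> is attained at an eigenvector
  of \<open>W\<^sup>T W\<close>, because \<open>1\<^sup>\<bottom>\<close> is invariant. Together with the eigenvector \<open>1\<close> for the eigenvalue
  \<open>1 \<ge> \<mu>\<close> it witnesses \<open>sqrt \<mu> \<le> \<sigma>\<close>.\<close>

lemma norm_le_second_singular_value:
  fixes W :: "real^'n::finite^'n"
  assumes nonneg: "\<And>i j. 0 \<le> W $ i $ j" and sym: "transpose W = W"
    and rows: "\<And>i. (\<Sum>j\<in>UNIV. W $ i $ j) = 1"
    and v: "v \<bullet> 1 = 0"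
  shows "norm (W *v v) \<le> second_singular_value W * norm v"
proof (cases "v = 0")
  case False
  define K where "K = {u :: real^'n. u \<bullet> 1 = 0} \<inter> sphere 0 1"
  have one: "W *v 1 = 1" by (rule matrix_vector_mult_ones[OF rows])
  have gram_one: "(transpose W ** W) *v 1 = 1"
    by (metis sym one matrix_vector_mul_assoc)
  have normalize: "(1 / norm u) *\<^sub>R u \<in> K" if "u \<bullet> 1 = 0" "u \<noteq> 0" for u
    using that by (simp add: K_def)
  have "compact K"
    unfolding K_def by (intro closed_Int_compact closed_Collect_eq continuous_intros compact_sphere)
  moreover have "K \<noteq> {}" using normalize[OF v False] by auto
  moreover have "continuous_on K (\<lambda>u. norm (W *v u))"
    by (intro continuous_intros linear_continuous_on matrix_vector_mul_bounded_linear)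
  ultimately obtain u where u: "u \<in> K" and max: "\<And>y. y \<in> K \<Longrightarrow> norm (W *v y) \<le> norm (W *v u)"
    using continuous_attains_sup[of K "\<lambda>u. norm (W *v u)"] by blast
  define s where "s = norm (W *v u)"
  have u1: "norm u = 1" "u \<bullet> 1 = 0" using u by (auto simp: K_def)
  have bound: "norm (W *v y) \<le> s * norm y" if "y \<bullet> 1 = 0" for y
  proof (cases "y = 0")
    case False
    have "norm (W *v ((1 / norm y) *\<^sub>R y)) \<le> s"
      unfolding s_def by (rule max[OF normalize[OF that False]])
    then show ?thesis
      using False by (simp add: matrix_vector_mult_scaleR field_simps)
  qed simp
  \<comment> \<open>The residual of the eigenvector equation. It vanishes by a first-order variation
    of the maximizer \<open>u\<close> in the direction \<open>g\<close>, which is admissible because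
    \<open>g\<close> is again orthogonal to \<open>1\<close>.\<close>
  define g where "g = (transpose W ** W) *v u - s\<^sup>2 *\<^sub>R u"
  have g1: "g \<bullet> 1 = 0"
    using inner_gram[of W u 1] inner_gram[of W 1 u] gram_one u1
    by (simp add: g_def inner_diff_left inner_diff_right inner_commute)
  \<comment> \<open>The squared bound at \<open>u + t g\<close>. The terms of order 0 cancel since
    \<open>u\<close> attains the maximum, and the linear terms leave exactly -2 t |g|^2.\<close>
  have quad: "0 \<le> t\<^sup>2 * (s\<^sup>2 * (norm g)\<^sup>2 - (norm (W *v g))\<^sup>2) - 2 * t * (g \<bullet> g)" for t
  proof -
    have "(u + t *\<^sub>R g) \<bullet> 1 = 0" using u1 g1 by (simp add: inner_add_left)
    from power_mono[OF bound[OF this] norm_ge_zero, of 2]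
    have "(W *v u + t *\<^sub>R (W *v g)) \<bullet> (W *v u + t *\<^sub>R (W *v g))
        \<le> s\<^sup>2 * ((u + t *\<^sub>R g) \<bullet> (u + t *\<^sub>R g))"
      by (simp add: power_mult_distrib power2_norm_eq_inner matrix_vector_right_distrib
          matrix_vector_mult_scaleR)
    moreover have "(W *v u) \<bullet> (W *v u) = s\<^sup>2" "u \<bullet> u = 1"
      using u1 by (auto simp: s_def power2_norm_eq_inner norm_eq_1)
    moreover have "(W *v u) \<bullet> (W *v g) = g \<bullet> g + s\<^sup>2 * (u \<bullet> g)"
      using inner_gram[of W u g] by (simp add: g_def inner_diff_left)
    ultimately show ?thesis
      unfolding power2_norm_eq_inner
      by (simp add: inner_add_left inner_add_right inner_commute algebra_simps power2_eq_square)
  qed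
  have "g = 0"
  proof (rule ccontr)
    assume "g \<noteq> 0"
    define c where "c = s\<^sup>2 * (norm g)\<^sup>2 - (norm (W *v g))\<^sup>2"
    \<comment> \<open>A positive \<open>t\<close> with \<open>t * c < 2 * (g \<bullet> g)\<close>
      makes the quadratic negative. The denominator is positive whatever the sign of
      \<open>c\<close>.\<close>
    define t where "t = (g \<bullet> g) / (\<bar>c\<bar> + 1)"
    have gg: "0 < g \<bullet> g" using \<open>g \<noteq> 0\<close> by simp
    then have "0 < t" by (simp add: t_def)
    have "t * c < 2 * (g \<bullet> g)"
    proof -
      have "t * c \<le> t * (\<bar>c\<bar> + 1)" using \<open>0 < t\<close> by (intro mult_left_mono) auto
      also have "\<dots> = g \<bullet> g" by (simp add: t_def)
      finally show ?thesis using gg by linarith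
    qed
    then have "t * (t * c) < t * (2 * (g \<bullet> g))" using \<open>0 < t\<close> by simp
    with quad[of t] show False unfolding c_def[symmetric] by (simp add: power2_eq_square mult_ac)
  qed
  then have "(transpose W ** W) *v u = s\<^sup>2 *\<^sub>R u" by (simp add: g_def)
  moreover have "s \<le> 1"
    using doubly_stochastic_norm_le[OF nonneg sym rows, of u] u1 by (simp add: s_def)
  moreover have "(transpose W ** W) *v 1 = 1\<^sup>2 *\<^sub>R 1" using gram_one by simp
  moreover have "u \<noteq> 0" using u1 by auto
  moreover have "(1 :: real^'n) \<noteq> 0" by (simp add: vec_eq_iff)
  ultimately have "s \<le> second_singular_value W"
    using u1 by (intro le_second_singular_value[of s 1 u 1 W]) (auto simp: s_def)
  with bound[OF v] show ?thesis
    by (meson mult_right_mono norm_ge_zero order_trans)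
qed simp

section \<open>Averages and deviations from consensus\<close>

lemma par_part_component: "par_part M $ i $ j = (\<Sum>l\<in>UNIV. M $ l $ j) / real CARD('n)"
  for M :: "real^'n::finite^'n"
  by (simp add: par_part_def matrix_matrix_mult_def)

lemma par_part_diff: "par_part (M - N) = par_part M - par_part N"
  by (simp add: vec_eq_iff par_part_component sum_subtractf diff_divide_distrib)

lemma par_part_perp_part: "par_part (perp_part M) = 0"
  by (simp add: perp_part_def par_part_diff) (simp add: vec_eq_iff par_part_component)

lemma perp_part_diff: "perp_part (M - N) = perp_part M - perp_part N"
  by (simp add: perp_part_def par_part_diff)

text \<open>Together with \<open>par_part_perp_part\<close> this makes averaging an orthogonal
  projection, which gives the Pythagorean identity below.\<close>

lemma par_part_self_adjoint: "par_part M \<bullet> N = M \<bullet> par_part N"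
  for M N :: "real^'n::finite^'n"
proof -
  have *: "P \<bullet> Q = (\<Sum>j\<in>UNIV. \<Sum>i\<in>UNIV. P $ i $ j * Q $ i $ j)" for P Q :: "real^'n^'n"
    by (simp add: inner_vec_def, rule sum.swap)
  show ?thesis
    unfolding * par_part_component
    by (simp add: sum_distrib_left[symmetric] sum_distrib_right[symmetric]
        sum_divide_distrib[symmetric])
qed

lemma norm_power2_par_perp: "(norm M)\<^sup>2 = (norm (par_part M))\<^sup>2 + (norm (perp_part M))\<^sup>2"
proof -
  have "par_part M \<bullet> perp_part M = 0"
    by (simp add: par_part_self_adjoint par_part_perp_part)
  moreover have "M = par_part M + perp_part M" by (simp add: perp_part_def)
  ultimately show ?thesis
    by (metis norm_add_Pythagorean orthogonal_def)
qed

lemma stochastic_mult_par_part: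
  assumes rows: "\<And>i. (\<Sum>j\<in>UNIV. W $ i $ j) = 1"
  shows "W ** par_part M = par_part M"
  using rows by (simp add: vec_eq_iff matrix_matrix_mult_def par_part_component
      sum_divide_distrib[symmetric] sum_distrib_right[symmetric])

lemma par_part_stochastic_mult:
  fixes W M :: "real^'n::finite^'n"
  assumes sym: "transpose W = W" and rows: "\<And>i. (\<Sum>j\<in>UNIV. W $ i $ j) = 1"
  shows "par_part (W ** M) = par_part M"
proof -
  have W: "W $ i $ j = W $ j $ i" for i j
    using sym by (metis transpose_def vec_lambda_beta)
  have "(\<Sum>l\<in>UNIV. \<Sum>p\<in>UNIV. W $ l $ p * M $ p $ j) = (\<Sum>p\<in>UNIV. (\<Sum>l\<in>UNIV. W $ p $ l) * M $ p $ j)" for j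
    by (subst sum.swap) (simp add: sum_distrib_right W)
  then show ?thesis
    by (simp add: vec_eq_iff par_part_component matrix_matrix_mult_def rows)
qed

text \<open>\<open>W\<close> preserves column averages and fixes consensus matrices, so it respects
  the splitting. It leaves the parallel part alone and contracts the rest, whose columns are
  orthogonal to \<open>1\<close>.\<close>

lemma norm_mixing_le:
  fixes W M :: "real^'n::finite^'n"
  assumes nonneg: "\<And>i j. 0 \<le> W $ i $ j" and sym: "transpose W = W"
    and rows: "\<And>i. (\<Sum>j\<in>UNIV. W $ i $ j) = 1"
  shows "(norm (W ** M))\<^sup>2
    \<le> (norm (par_part M))\<^sup>2 + (second_singular_value W)\<^sup>2 * (norm (perp_part M))\<^sup>2"
proof -
  have "perp_part (W ** M) = W ** perp_part M"
    by (simp add: perp_part_def par_part_stochastic_mult[OF sym rows] matrix_diff_ldistrib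
        stochastic_mult_par_part[OF rows])
  moreover have "column j (perp_part M) \<bullet> 1 = 0" for j
  proof -
    \<comment> \<open>All rows of a \<open>par_part\<close> agree, so any row index gives the column
      average.\<close>
    have "par_part (perp_part M) $ undefined $ j = 0" by (simp add: par_part_perp_part)
    then show ?thesis by (simp add: par_part_component inner_vec_def column_def)
  qed
  then have "(norm (W ** perp_part M))\<^sup>2 \<le> (second_singular_value W)\<^sup>2 * (norm (perp_part M))\<^sup>2"
    by (intro norm_matrix_mult_le_columns norm_le_second_singular_value nonneg sym rows)
  ultimately show ?thesis
    by (simp add: norm_power2_par_perp[of "W ** M"] par_part_stochastic_mult[OF sym rows])
qed

section \<open>The constraint set and the Lipschitz bound for the gradient matrix\<close>

lemma convex_Omega_a:
  assumes "\<And>i. convex (\<Omega> i)"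
  shows "convex (Omega_a \<Omega>)"
  using assms by (auto simp: convex_def Omega_a_def action_profiles_def diag_def)

lemma closed_Omega_a:
  fixes \<Omega> :: "'n::finite \<Rightarrow> real set"
  assumes "\<And>i. closed (\<Omega> i)"
  shows "closed (Omega_a \<Omega>)"
proof -
  have "Omega_a \<Omega> = (\<Inter>i. (\<lambda>M. M $ i $ i) -` \<Omega> i)"
    by (auto simp: Omega_a_def action_profiles_def diag_def)
  then show ?thesis
    using assms by (auto intro!: closed_INT closed_vimage continuous_intros)
qed

lemma set_action_self: "set_action i (v $ i) v = v"
  by (simp add: set_action_def vec_eq_iff)

text \<open>The path goes through the own action of \<open>v\<close> with the opponents of
  \<open>w\<close>. The order matters: the opponents change while the own action is
  \<open>v $ i\<close>, which lies in \<open>A\<close>, whereas \<open>w $ i\<close> is only known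
  to lie in \<open>B\<close>.\<close>

lemma own_grad_diff_le:
  fixes v w :: "real^'n::finite"
  assumes own: "own_lipschitz J i A B p" and others: "others_lipschitz J i A q"
    and v: "v $ i \<in> A" and w: "w $ i \<in> B"
  shows "\<bar>own_grad J i v - own_grad J i w\<bar> \<le> sqrt (p\<^sup>2 + q\<^sup>2) * norm (v - w)"
proof -
  define d where "d = L2_set (\<lambda>j. v $ j - w $ j) (- {i})"
  define e where "e = \<bar>v $ i - w $ i\<bar>"
  have "\<bar>own_grad J i v - own_grad J i (set_action i (v $ i) w)\<bar> \<le> q * d"
    using others v unfolding others_lipschitz_def d_def by (metis set_action_self)
  moreover have "\<bar>own_grad J i (set_action i (v $ i) w) - own_grad J i w\<bar> \<le> p * e"
    using own v w unfolding own_lipschitz_def e_def by (metis set_action_self)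
  ultimately have "\<bar>own_grad J i v - own_grad J i w\<bar> \<le> p * e + q * d" by linarith
  also have "\<dots> \<le> sqrt ((p\<^sup>2 + q\<^sup>2) * (e\<^sup>2 + d\<^sup>2))"
  proof (rule real_le_rsqrt)
    \<comment> \<open>Lagrange's identity, that is, Cauchy-Schwarz in the plane with its
      defect.\<close>
    have "(p\<^sup>2 + q\<^sup>2) * (e\<^sup>2 + d\<^sup>2) - (p * e + q * d)\<^sup>2 = (p * d - q * e)\<^sup>2"
      by (simp add: power2_eq_square algebra_simps)
    then show "(p * e + q * d)\<^sup>2 \<le> (p\<^sup>2 + q\<^sup>2) * (e\<^sup>2 + d\<^sup>2)"
      using zero_le_power2[of "p * d - q * e"] by linarith
  qed
  also have "e\<^sup>2 + d\<^sup>2 = (norm (v - w))\<^sup>2"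
    by (simp add: norm_vec_def L2_set_def d_def e_def sum_nonneg Compl_eq_Diff_UNIV
        sum.remove[of UNIV i])
  finally show ?thesis by (simp add: real_sqrt_mult)
qed

text \<open>Gradient matrices are diagonal, so a row of the difference has at most one nonzero
  entry, and the previous bound applies row by row. The sets \<open>B i\<close> admit for
  \<open>N\<close> a mixed iterate whose diagonal leaves the action sets.\<close>

lemma grad_matrix_diff_le:
  fixes M N :: "real^'n::finite^'n"
  assumes own: "\<And>i. own_lipschitz J i (\<Omega> i) (B i) (Lo i)"
    and others: "\<And>i. others_lipschitz J i (\<Omega> i) (Lc i)"
    and L: "\<And>i. sqrt ((Lo i)\<^sup>2 + (Lc i)\<^sup>2) \<le> L"
    and M: "M \<in> Omega_a \<Omega>" and N: "\<And>i. N $ i $ i \<in> B i"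
  shows "norm (grad_matrix J M - grad_matrix J N) \<le> L * norm (M - N)"
proof (rule power2_le_imp_le)
  have L0: "0 \<le> L" using order_trans[OF real_sqrt_ge_zero L] by simp
  then show "0 \<le> L * norm (M - N)" by simp
  have "(norm ((grad_matrix J M - grad_matrix J N) $ i))\<^sup>2 \<le> L\<^sup>2 * (norm ((M - N) $ i))\<^sup>2" for i
  proof -
    have "(norm ((grad_matrix J M - grad_matrix J N) $ i))\<^sup>2
        = (\<Sum>j\<in>UNIV. if i = j then (own_grad J i (M $ i) - own_grad J i (N $ i))\<^sup>2 else 0)"
      unfolding power2_norm_eq_inner inner_vec_def
      by (intro sum.cong) (auto simp: grad_matrix_def row_def power2_eq_square)
    also have "\<dots> = \<bar>own_grad J i (M $ i) - own_grad J i (N $ i)\<bar>\<^sup>2"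
      by simp
    also have "\<dots> \<le> (sqrt ((Lo i)\<^sup>2 + (Lc i)\<^sup>2) * norm (M $ i - N $ i))\<^sup>2"
      using M N
      by (intro power_mono own_grad_diff_le[OF own others])
        (auto simp: Omega_a_def action_profiles_def diag_def)
    also have "\<dots> \<le> (L * norm (M $ i - N $ i))\<^sup>2"
      by (intro power_mono mult_right_mono L) auto
    finally show ?thesis by (simp add: power_mult_distrib)
  qed
  then show "(norm (grad_matrix J M - grad_matrix J N))\<^sup>2 \<le> (L * norm (M - N))\<^sup>2"
    unfolding power_mult_distrib norm_matrix_power2[of "M - N"]
      norm_matrix_power2[of "grad_matrix J M - grad_matrix J N"] sum_distrib_left
    by (rule sum_mono)
qed

section \<open>Inequalities for the one-step estimate\<close>

lemma weighted_Young:
  fixes a b c p q :: real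
  assumes "c\<^sup>2 \<le> a * b" "0 \<le> a" "0 \<le> b" "0 \<le> p" "0 \<le> q"
  shows "c * p * q \<le> a / 2 * p\<^sup>2 + b / 2 * q\<^sup>2"
proof -
  have "c * (p * q) \<le> sqrt a * sqrt b * (p * q)"
    using real_le_rsqrt[OF assms(1)] assms by (intro mult_right_mono) (auto simp: real_sqrt_mult)
  moreover have "0 \<le> (sqrt a * p - sqrt b * q)\<^sup>2" by simp
  then have "2 * (sqrt a * sqrt b * (p * q)) \<le> a * p\<^sup>2 + b * q\<^sup>2"
    using assms by (simp add: power2_diff power_mult_distrib mult_ac)
  ultimately show ?thesis by (simp add: mult.assoc)
qed

text \<open>The two sides differ by |u - (w - v)|^2. The purpose is to eliminate \<open>u\<close>,
  the error of the next iterate.\<close>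

lemma three_point_estimate:
  fixes u v w :: "'a::real_inner"
  shows "(norm (u - v))\<^sup>2 - (norm (u - w))\<^sup>2 - (norm u)\<^sup>2
    \<le> (norm (w - v))\<^sup>2 + (norm v)\<^sup>2 - (norm w)\<^sup>2"
proof -
  have "(norm (w - v))\<^sup>2 + (norm v)\<^sup>2 - (norm w)\<^sup>2
      - ((norm (u - v))\<^sup>2 - (norm (u - w))\<^sup>2 - (norm u)\<^sup>2) = (norm (u - (w - v)))\<^sup>2"
    by (simp add: power2_norm_eq_inner algebra_simps inner_commute)
  then show ?thesis using zero_le_power2[of "norm (u - (w - v))"] by linarith
qed

text \<open>The weight of |W M|^2 is split as (1 - \<eta>) + \<eta>. The \<eta> share cancels the
  negative square in \<open>three_point_estimate\<close>, leaving |(W - I) M|^2 + |M|^2; the other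
  share is contracted by \<open>norm_mixing_le\<close>.\<close>

lemma mixing_estimate:
  fixes W M u :: "real^'n::finite^'n"
  assumes W: "\<And>i j. 0 \<le> W $ i $ j" "transpose W = W" "\<And>i. (\<Sum>j\<in>UNIV. W $ i $ j) = 1"
    and \<eta>: "0 \<le> \<eta>" "\<eta> \<le> 1"
  shows "(norm (W ** M))\<^sup>2 + \<eta> * ((norm (u - M))\<^sup>2 - (norm (u - W ** M))\<^sup>2 - (norm u)\<^sup>2)
    \<le> (1 + \<eta> * (norm (W - mat 1))\<^sup>2) * (norm (par_part M))\<^sup>2
      + ((1 - \<eta>) * (second_singular_value W)\<^sup>2 + \<eta> * (1 + (norm (W - mat 1))\<^sup>2))
        * (norm (perp_part M))\<^sup>2"
proof -
  let ?N = "(norm (W - mat 1))\<^sup>2" and ?s = "(second_singular_value W)\<^sup>2"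
  let ?p = "(norm (par_part M))\<^sup>2" and ?q = "(norm (perp_part M))\<^sup>2"
  have "(norm (W ** M - M))\<^sup>2 \<le> ?N * (?p + ?q)"
    using norm_matrix_mult_le[of "W - mat 1" M]
    by (simp add: matrix_diff_rdistrib norm_power2_par_perp[of M])
  with three_point_estimate[of u M "W ** M"]
  have "\<eta> * ((norm (u - M))\<^sup>2 - (norm (u - W ** M))\<^sup>2 - (norm u)\<^sup>2)
      \<le> \<eta> * (?N * (?p + ?q) + (?p + ?q) - (norm (W ** M))\<^sup>2)"
    using norm_power2_par_perp[of M] \<eta> by (intro mult_left_mono) linarith+
  moreover have "(1 - \<eta>) * (norm (W ** M))\<^sup>2 \<le> (1 - \<eta>) * (?p + ?s * ?q)"
    using norm_mixing_le[OF W, of M] \<eta> by (intro mult_left_mono) auto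
  ultimately show ?thesis by (simp add: algebra_simps)
qed

lemma three_point_identity:
  fixes u w :: "'a::real_inner"
  shows "(w - u) \<bullet> u = ((norm w)\<^sup>2 - (norm (u - w))\<^sup>2 - (norm u)\<^sup>2) / 2"
  by (simp add: power2_norm_eq_inner algebra_simps inner_commute)

section \<open>The one-step inequality and its summation\<close>

theorem proposition1:
  fixes J :: "'n::finite \<Rightarrow> real^'n \<Rightarrow> real"
    and \<Omega> :: "'n \<Rightarrow> real set"
    and \<A> :: "'n set set"
    and W :: "real^'n^'n"
    and Lo Lc :: "'n \<Rightarrow> real"
    and L \<sigma> :: real
    and \<alpha> lam \<eta> \<theta> :: "nat \<Rightarrow> real"
    and X X' :: "nat \<Rightarrow> real^'n^'n"
    and x :: "real^'n^'n"
    and k :: nat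
  assumes "\<And>i. convex (\<Omega> i)" and "\<And>i. closed (\<Omega> i)"
    and "\<And>i z. convex_on UNIV (\<lambda>a. J i (set_action i a z))"
    and "\<And>i z. (\<lambda>a. J i (set_action i a z)) C1_differentiable_on UNIV"
    and "\<And>i. 0 \<le> Lo i" and "\<And>i. 0 \<le> Lc i"
    and "\<And>i. own_lipschitz J i (\<Omega> i) (\<Omega> i) (Lo i)"
    and "\<And>i. others_lipschitz J i (\<Omega> i) (Lc i)"
    and "L = Max (range (\<lambda>i. sqrt ((Lo i)\<^sup>2 + (Lc i)\<^sup>2)))"
    and "undirected_arcs \<A>" and "graph_connected \<A>" and "mixing_matrix \<A> W"
    and "\<sigma> = second_singular_value W" and "0 < \<sigma>" and "\<sigma> < 1"
    and "\<And>t. 0 < \<alpha> t" and "\<And>t. 1 \<le> t \<Longrightarrow> 0 < lam t"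
    and "algorithm_run J \<Omega> W \<alpha> lam X X'"
    and "own_lipschitz_at_mixed J \<Omega> X' Lo"
    and "\<And>t. 0 < \<eta> t" and "\<And>t. \<eta> t < 1" and "\<And>t. 0 < \<theta> t"
    and "\<And>t. 1 \<le> t \<Longrightarrow>
           \<theta> (t - 1) * \<eta> t * (1 - \<eta> (t - 1)) \<ge> \<theta> t * L\<^sup>2 * (\<alpha> t)\<^sup>2 * (lam t)\<^sup>2"
    and "\<And>t. \<theta> (t + 1) * \<alpha> (t + 1) * lam (t + 1) = \<theta> t * \<alpha> t"
    and "x = par_part x" and "x \<in> Omega_a \<Omega>"
    and "1 \<le> k"
  shows "(\<Sum>t = 1..k.
            \<theta> t * \<alpha> t * (grad_matrix J (X (t + 1)) \<bullet> (X (t + 1) - x))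
            + \<theta> t * (1 - \<eta> t) / 2 * (norm (X (t + 1) - x))\<^sup>2)
         - L\<^sup>2 * \<theta> k * (\<alpha> k)\<^sup>2 / (2 * (1 - \<eta> k)) * (norm (X (k + 1) - x))\<^sup>2
       \<le> (\<Sum>t = 1..k.
            \<theta> t * ((1 + \<eta> t * (norm (W - mat 1))\<^sup>2) / 2) * (norm (par_part (X t) - x))\<^sup>2
            + \<theta> t * (((1 - \<eta> t) * \<sigma>\<^sup>2 + \<eta> t * (1 + (norm (W - mat 1))\<^sup>2)) / 2)
                * (norm (perp_part (X t)))\<^sup>2)"
proof -
  have W: "\<And>i j. 0 \<le> W $ i $ j" "transpose W = W" "\<And>i. (\<Sum>j\<in>UNIV. W $ i $ j) = 1"
    using assms(12) unfolding mixing_matrix_def by auto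
  note \<sigma> = assms(13)
  have pos: "0 < \<alpha> t" "0 < \<eta> t" "\<eta> t < 1" "0 < \<theta> t" for t
    using assms(16,20,21,22) by auto
  note lam = assms(17)
  have X': "X' t = W ** X t" and X1: "X 1 = X' 0" for t
    using assms(18) by (auto simp: algorithm_run_def)
  have X: "X (t + 1) = closest_point (Omega_a \<Omega>)
        (X' t - \<alpha> t *\<^sub>R (grad_matrix J (X' t)
                 + lam t *\<^sub>R (grad_matrix J (X t) - grad_matrix J (X' (t - 1)))))"
    if "1 \<le> t" for t
    using assms(18) that by (simp add: algorithm_run_def)
  note closed = closed_Omega_a[of \<Omega>, OF assms(2)] and convex = convex_Omega_a[of \<Omega>, OF assms(1)]
  define \<Delta> where "\<Delta> t = grad_matrix J (X (t + 1)) - grad_matrix J (X' t)" for t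
  have \<Delta>_le: "norm (\<Delta> t) \<le> L * norm (X (t + 1) - X' t)" for t
  proof (cases "t = 0")
    \<comment> \<open>\<open>X 1\<close> is a mixed iterate, not a projection, and may lie outside
      \<open>Omega_a \<Omega>\<close>; here both sides are 0.\<close>
    case True
    then show ?thesis using X1 by (simp add: \<Delta>_def)
  next
    case False
    have "X (t + 1) \<in> Omega_a \<Omega>"
      using False assms(26) by (subst X) (auto intro!: closest_point_in_set closed)
    moreover have "X' t $ i $ i \<in> {X' k $ i $ i | k. 1 \<le> k}" for i
      using False by (auto intro!: exI[of _ t])
    moreover have "sqrt ((Lo i)\<^sup>2 + (Lc i)\<^sup>2) \<le> L" for i
      unfolding assms(9) by (intro Max_ge) auto
    ultimately show ?thesis
      unfolding \<Delta>_def using assms(8,19)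
      by (intro grad_matrix_diff_le[where B = "\<lambda>i. {X' k $ i $ i | k. 1 \<le> k}"])
        (auto simp: own_lipschitz_at_mixed_def)
  qed
  \<comment> \<open>These let \<open>mixing_estimate\<close> act on \<open>X t - x\<close>: the
    mixed error is \<open>W\<close> times the error, and subtracting \<open>x\<close> changes only
    the parallel part.\<close>
  have Wx: "W ** x = x" and perp_x: "perp_part x = 0"
    using stochastic_mult_par_part[OF W(3), of x] assms(25) by (simp_all add: perp_part_def)

  define G where "G t = \<theta> t * \<alpha> t * (grad_matrix J (X (t + 1)) \<bullet> (X (t + 1) - x))
      + \<theta> t * (1 - \<eta> t) / 2 * (norm (X (t + 1) - x))\<^sup>2" for t
  define R where "R t = \<theta> t * ((1 + \<eta> t * (norm (W - mat 1))\<^sup>2) / 2) * (norm (par_part (X t) - x))\<^sup>2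
      + \<theta> t * (((1 - \<eta> t) * \<sigma>\<^sup>2 + \<eta> t * (1 + (norm (W - mat 1))\<^sup>2)) / 2)
        * (norm (perp_part (X t)))\<^sup>2" for t
  define T where "T t = \<theta> t * \<alpha> t * (\<Delta> t \<bullet> (X (t + 1) - x))" for t
  define E where "E t = \<theta> t * (1 - \<eta> t) / 2 * (norm (X (t + 1) - X' t))\<^sup>2" for t

  \<comment> \<open>With \<open>Suc t\<close> for the current index, the previous one is
    \<open>t\<close>, and the first step draws on \<open>T 0\<close> and \<open>E 0\<close>.\<close>
  have step: "G (Suc t) \<le> R (Suc t) + (T (Suc t) - T t) - (E (Suc t) - E t)" for t
  proof -
    let ?s = "Suc t"
    define u v w where "u = X (?s + 1) - x" and "v = X ?s - x" and "w = X' ?s - x"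
    have w: "w = W ** v"
      by (simp add: w_def v_def X' matrix_diff_ldistrib Wx)
    define y where "y = X' ?s - \<alpha> ?s *\<^sub>R (grad_matrix J (X' ?s) + lam ?s *\<^sub>R \<Delta> t)"
    have "X (?s + 1) = closest_point (Omega_a \<Omega>) y"
      using X[of ?s] by (simp add: y_def \<Delta>_def)
    then have "(y - X (?s + 1)) \<bullet> (x - X (?s + 1)) \<le> 0"
      using closest_point_dot[OF convex closed assms(26)] by simp
    moreover have "y - X (?s + 1) = w - \<alpha> ?s *\<^sub>R (grad_matrix J (X' ?s) + lam ?s *\<^sub>R \<Delta> t) - u"
      and "x - X (?s + 1) = - u"
      by (simp_all add: y_def u_def w_def)
    ultimately have "(w - \<alpha> ?s *\<^sub>R (grad_matrix J (X' ?s) + lam ?s *\<^sub>R \<Delta> t) - u) \<bullet> (- u) \<le> 0"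
      by simp
    \<comment> \<open>Trading the gradient at the mixed iterate for the one at the new iterate
      produces the term that becomes \<open>T ?s\<close>.\<close>
    moreover have "grad_matrix J (X' ?s) = grad_matrix J (X (?s + 1)) - \<Delta> ?s"
      by (simp add: \<Delta>_def)
    ultimately have proj: "\<alpha> ?s * (grad_matrix J (X (?s + 1)) \<bullet> u - \<Delta> ?s \<bullet> u + lam ?s * (\<Delta> t \<bullet> u))
        \<le> ((norm w)\<^sup>2 - (norm (u - w))\<^sup>2 - (norm u)\<^sup>2) / 2"
      unfolding three_point_identity[symmetric]
      by (simp add: inner_diff_left inner_diff_right inner_add_left inner_add_right)
    have "- (\<Delta> t \<bullet> (u - v)) \<le> L * norm (X ?s - X' t) * norm (u - v)"
    proof -
      have "- (\<Delta> t \<bullet> (u - v)) \<le> norm (\<Delta> t) * norm (u - v)"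
        using Cauchy_Schwarz_ineq2[of "\<Delta> t" "u - v"] by linarith
      also have "\<dots> \<le> L * norm (X ?s - X' t) * norm (u - v)"
        using \<Delta>_le[of t] by (intro mult_right_mono) auto
      finally show ?thesis .
    qed
    then have "(\<theta> ?s * \<alpha> ?s * lam ?s) * - (\<Delta> t \<bullet> (u - v))
        \<le> (\<theta> ?s * \<alpha> ?s * lam ?s) * (L * norm (X ?s - X' t) * norm (u - v))"
      using pos lam[of ?s] by (intro mult_left_mono) (auto simp: less_imp_le)
    also have "\<dots> = (\<theta> ?s * \<alpha> ?s * lam ?s * L) * norm (u - v) * norm (X ?s - X' t)"
      by (simp add: mult_ac)
    \<comment> \<open>The weights are \<open>\<theta> ?s * \<eta> ?s\<close> and
      \<open>\<theta> t * (1 - \<eta> t)\<close>. Their product dominates the squared coefficient by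
      the first parameter condition multiplied by \<open>\<theta> ?s\<close>.\<close>
    also have "\<dots> \<le> \<theta> ?s * \<eta> ?s / 2 * (norm (u - v))\<^sup>2
        + \<theta> t * (1 - \<eta> t) / 2 * (norm (X ?s - X' t))\<^sup>2"
    proof (rule weighted_Young)
      have "(\<theta> ?s * \<alpha> ?s * lam ?s * L)\<^sup>2
          = \<theta> ?s * (\<theta> ?s * L\<^sup>2 * (\<alpha> ?s)\<^sup>2 * (lam ?s)\<^sup>2)"
        by (simp add: power2_eq_square mult_ac)
      also have "\<dots> \<le> \<theta> ?s * (\<theta> t * \<eta> ?s * (1 - \<eta> t))"
        using assms(23)[of ?s] pos(4)[of ?s] by (intro mult_left_mono) auto
      finally show "(\<theta> ?s * \<alpha> ?s * lam ?s * L)\<^sup>2 \<le> \<theta> ?s * \<eta> ?s * (\<theta> t * (1 - \<eta> t))"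
        by (simp add: mult_ac)
    qed (use pos[of t] pos[of ?s] in auto)
    finally have young: "(\<theta> ?s * \<alpha> ?s * lam ?s) * - (\<Delta> t \<bullet> (u - v))
        \<le> \<theta> ?s * \<eta> ?s / 2 * (norm (u - v))\<^sup>2 + E t"
      by (simp add: E_def)
    \<comment> \<open>The second parameter condition: with u = v + (u - v), the part along
      \<open>v\<close> is exactly the previous \<open>T t\<close>.\<close>
    have "\<theta> ?s * \<alpha> ?s * lam ?s = \<theta> t * \<alpha> t" using assms(24)[of t] by simp
    then have T: "(\<theta> ?s * \<alpha> ?s * lam ?s) * (\<Delta> t \<bullet> v) = T t"
      by (simp add: T_def v_def)
    have split: "(\<theta> ?s * \<alpha> ?s * lam ?s) * (\<Delta> t \<bullet> u)
        = T t + (\<theta> ?s * \<alpha> ?s * lam ?s) * (\<Delta> t \<bullet> (u - v))"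
      unfolding T[symmetric] by (simp add: inner_diff_right right_diff_distrib)
    have "\<theta> ?s * (\<alpha> ?s * (grad_matrix J (X (?s + 1)) \<bullet> u - \<Delta> ?s \<bullet> u + lam ?s * (\<Delta> t \<bullet> u)))
        \<le> \<theta> ?s * (((norm w)\<^sup>2 - (norm (u - w))\<^sup>2 - (norm u)\<^sup>2) / 2)"
      using proj pos(4)[of ?s] by (intro mult_left_mono) auto
    then have "\<theta> ?s * \<alpha> ?s * (grad_matrix J (X (?s + 1)) \<bullet> u) - T ?s
          + (\<theta> ?s * \<alpha> ?s * lam ?s) * (\<Delta> t \<bullet> u)
        \<le> \<theta> ?s / 2 * ((norm w)\<^sup>2 - (norm (u - w))\<^sup>2 - (norm u)\<^sup>2)"
      by (simp add: T_def u_def algebra_simps)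
    with split young have main: "\<theta> ?s * \<alpha> ?s * (grad_matrix J (X (?s + 1)) \<bullet> u)
        \<le> T ?s - T t + E t + \<theta> ?s * \<eta> ?s / 2 * (norm (u - v))\<^sup>2
          + \<theta> ?s / 2 * ((norm w)\<^sup>2 - (norm (u - w))\<^sup>2 - (norm u)\<^sup>2)"
      by linarith
    have parperp: "par_part v = par_part (X ?s) - x" "perp_part v = perp_part (X ?s)"
      using assms(25) perp_x by (auto simp: v_def par_part_diff perp_part_diff)
    have "\<theta> ?s / 2 * ((norm w)\<^sup>2 + \<eta> ?s * ((norm (u - v))\<^sup>2 - (norm (u - w))\<^sup>2 - (norm u)\<^sup>2))
        \<le> \<theta> ?s / 2 * ((1 + \<eta> ?s * (norm (W - mat 1))\<^sup>2) * (norm (par_part v))\<^sup>2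
          + ((1 - \<eta> ?s) * \<sigma>\<^sup>2 + \<eta> ?s * (1 + (norm (W - mat 1))\<^sup>2)) * (norm (perp_part v))\<^sup>2)"
      unfolding \<sigma> w using pos[of ?s] by (intro mult_left_mono mixing_estimate W) auto
    also have "\<dots> = R ?s"
      unfolding parperp R_def by (simp add: field_simps)
    finally have mix: "\<theta> ?s / 2 * ((norm w)\<^sup>2
        + \<eta> ?s * ((norm (u - v))\<^sup>2 - (norm (u - w))\<^sup>2 - (norm u)\<^sup>2)) \<le> R ?s" .
    \<comment> \<open>The negative squares are split into shares \<eta> and 1 - \<eta>. The \<eta>
      shares enter the mixing estimate; the rest of |u - w|^2 is \<open>E ?s\<close>, kept for the
      next step, and the rest of |u|^2 is the distance term of \<open>G ?s\<close>.\<close>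
    have "E ?s = \<theta> ?s * (1 - \<eta> ?s) / 2 * (norm (u - w))\<^sup>2"
      by (simp add: E_def u_def w_def)
    then have "\<theta> ?s * \<eta> ?s / 2 * (norm (u - v))\<^sup>2
          + \<theta> ?s / 2 * ((norm w)\<^sup>2 - (norm (u - w))\<^sup>2 - (norm u)\<^sup>2)
        = \<theta> ?s / 2 * ((norm w)\<^sup>2 + \<eta> ?s * ((norm (u - v))\<^sup>2 - (norm (u - w))\<^sup>2 - (norm u)\<^sup>2))
          - E ?s - \<theta> ?s * (1 - \<eta> ?s) / 2 * (norm u)\<^sup>2"
      by (simp add: field_simps)
    with main mix show ?thesis unfolding G_def u_def by linarith
  qed
  have "T 0 = 0" "E 0 = 0" using X1 by (simp_all add: T_def E_def \<Delta>_def)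
  then have "(\<Sum>t = 1..m. G t) \<le> (\<Sum>t = 1..m. R t) + T m - E m" for m
  proof (induction m)
    case (Suc m)
    then show ?case using step[of m] by simp
  qed simp
  \<comment> \<open>No later step cancels the last \<open>T k\<close>. The unspent
    \<open>E k\<close> absorbs it up to the correction term on the left of the claim.\<close>
  moreover have "T k \<le> E k + L\<^sup>2 * \<theta> k * (\<alpha> k)\<^sup>2 / (2 * (1 - \<eta> k)) * (norm (X (k + 1) - x))\<^sup>2"
  proof -
    have "\<Delta> k \<bullet> (X (k + 1) - x) \<le> norm (\<Delta> k) * norm (X (k + 1) - x)"
      by (rule norm_cauchy_schwarz)
    also have "\<dots> \<le> L * norm (X (k + 1) - X' k) * norm (X (k + 1) - x)"
      using \<Delta>_le by (intro mult_right_mono) auto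
    finally have "T k \<le> \<theta> k * \<alpha> k * (L * norm (X (k + 1) - X' k) * norm (X (k + 1) - x))"
      unfolding T_def using pos by (intro mult_left_mono) (auto simp: less_imp_le)
    also have "\<dots> = (\<theta> k * \<alpha> k * L) * norm (X (k + 1) - X' k) * norm (X (k + 1) - x)"
      by (simp add: mult_ac)
    \<comment> \<open>The second weight is chosen so that its product with
      \<open>\<theta> k * (1 - \<eta> k)\<close> is exactly the square of
      \<open>\<theta> k * \<alpha> k * L\<close>.\<close>
    also have "\<dots> \<le> \<theta> k * (1 - \<eta> k) / 2 * (norm (X (k + 1) - X' k))\<^sup>2
        + L\<^sup>2 * \<theta> k * (\<alpha> k)\<^sup>2 / (1 - \<eta> k) / 2 * (norm (X (k + 1) - x))\<^sup>2"
      using pos[of k] by (intro weighted_Young) (auto simp: power2_eq_square)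
    finally show ?thesis by (simp add: E_def mult.commute)
  qed
  ultimately show ?thesis
    unfolding G_def[symmetric] R_def[symmetric] by (smt (verit))
qed

end
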